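(* Let $\frac1{1+\nu}<\delta<1$, $r:=\frac1{2(1-\delta)}$, $A:=\big(\frac{8\delta r}{\tau^2}\big)^{\delta r}$, and $\lambda:=\frac12\tau A^{1/\delta}$. Let $$k_0:=\max\left\{4\delta r,\ A^{\frac1{\delta r}}\Big(\frac{2\rho}{\mu}\Big)^{\frac{2(1-\delta)}{\delta(1+\nu)-1}}\right\}.$$ Let $\{x_k\}_{k\ge0}$ be generated by the projected subgradient method with step-size $\alpha_k=\lambda(k+k_0)^{-r}$ and initial point $x_0\in\mathcal{T}_{1/2}$ satisfying $\operatorname{dist}(x_0;\mathcal{X}^* )\le Ak_0^{-\delta r}$. Then, for all $k\ge0$, $$\operatorname{dist}(x_k;\mathcal{X}^* )\le\frac{A}{(k+k_0)^{\delta r}}.$$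
   Context: $\|\cdot\|$ is the Euclidean norm on $\mathbb{R}^n$, $\operatorname{dist}(x;S)=\inf_{z\in S}\|z-x\|$, $\operatorname{proj}_X$ is the Euclidean projection onto $X$, $\operatorname{dom}(f)=\{x:f(x)<+\infty\}$, and $\partial f$ is the Clarke subdifferential. Standing assumptions: $f:\mathbb{R}^n\to\mathbb{R}\cup\{+\infty\}$ is proper; $X\subseteq\operatorname{dom}(f)$ is nonempty, closed and convex; the set of minimizers $\mathcal{X}^*=\operatorname{argmin}_{x\in X}f(x)$ is nonempty and $f^*$ is the minimal value of $f$ over $X$. The parameters satisfy $\rho>0$, $0<\nu\le1$, $\frac1{1+\nu}<\delta\le1$, $\mu>0$ (here the claim takes $\delta<1$), and: (i) $f$ is $\nu$-paraconvex with constant $\rho$ on an open convex set $X'$ with $X\subseteq X'\subseteq\operatorname{dom}(f)$, i.e. $f(\lambda x+(1-\lambda)y)\le\lambda f(x)+(1-\lambda)f(y)+\rho\min\{\lambda,1-\lambda\}\|x-y\|^{1+\nu}$ for all $x,y\in X'$, $\lambda\in[0,1]$ (consequently $f$ is locally Lipschitz on $X'$); (ii) Hölderian error bound: $\mu\operatorname{dist}^{1/\delta}(x;\mathcal{X}^* )\le f(x)-f^*$ for all $x\in X$. For $\gamma\in(0,1]$ let $\mathcal{T}_\gamma=\big\{x\in X:\operatorname{dist}(x;\mathcal{X}^* )<(\gamma\mu/\rho)^{\delta/(\delta(1+\nu)-1)}\big\}$. Let $L=\sup\{\|\zeta\|:\zeta\in\partial f(x),\ x\in\mathcal{T}_1\}$,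 with $0<L<\infty$, and $\tau=\mu/L$. Projected subgradient method with step-sizes $\alpha_k$: from the initial point, at each iteration choose any $\zeta_k\in\partial f(x_k)$ and set $x_{k+1}=\operatorname{proj}_X\big(x_k-\alpha_k\zeta_k/\|\zeta_k\|\big)$; if $\zeta_k=0$, set $x_{k+1}=x_k$. *)

theory Defs
  imports "HOL-Analysis.Analysis"
begin

definition edom :: "('a \<Rightarrow> ereal) \<Rightarrow> 'a set" where
  "edom f = {x. f x < \<infinity>}"

definition proper_fun :: "('a \<Rightarrow> ereal) \<Rightarrow> bool" where
  "proper_fun f \<longleftrightarrow> (\<forall>x. f x \<noteq> -\<infinity>) \<and> edom f \<noteq> {}"

definition minimizers :: "('a \<Rightarrow> ereal) \<Rightarrow> 'a set \<Rightarrow> 'a set" where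
  "minimizers f X = {x. is_arg_min f (\<lambda>x. x \<in> X) x}"

definition paraconvex_on ::
    "'a::real_normed_vector set \<Rightarrow> real \<Rightarrow> real \<Rightarrow> ('a \<Rightarrow> ereal) \<Rightarrow> bool" where
  "paraconvex_on S \<nu> \<rho> f \<longleftrightarrow>
     (\<forall>x\<in>S. \<forall>y\<in>S. \<forall>t\<in>{0..1}.
        f (t *\<^sub>R x + (1 - t) *\<^sub>R y)
          \<le> ereal t * f x + ereal (1 - t) * f y
             + ereal (\<rho> * min t (1 - t) * norm (x - y) powr (1 + \<nu>)))"

text \<open>
  Clarke's generalized directional derivative: the upper limit of the quotients
  (f(y + t v) - f(y)) / t as y tends to x (y = x allowed) and t decreases to 0.
  It and the subdifferential below are Clarke's notions for a function that is finite
  and locally Lipschitz near x; they are only meant to be used at such points.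
\<close>

definition clarke_dderiv ::
    "('a::real_normed_vector \<Rightarrow> ereal) \<Rightarrow> 'a \<Rightarrow> 'a \<Rightarrow> ereal" where
  "clarke_dderiv f x v =
     Limsup (nhds x \<times>\<^sub>F at_right (0::real)) (\<lambda>(y, t). (f (y + t *\<^sub>R v) - f y) / ereal t)"

definition clarke_subdiff :: "('a::real_inner \<Rightarrow> ereal) \<Rightarrow> 'a \<Rightarrow> 'a set" where
  "clarke_subdiff f x = {\<zeta>. \<forall>v. ereal (\<zeta> \<bullet> v) \<le> clarke_dderiv f x v}"

definition tube ::
    "('a::metric_space \<Rightarrow> ereal) \<Rightarrow> 'a set \<Rightarrow> real \<Rightarrow> real \<Rightarrow> real \<Rightarrow> real \<Rightarrow> real \<Rightarrow> 'a set" where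
  "tube f X \<nu> \<delta> \<mu> \<rho> \<gamma> =
     {x \<in> X. infdist x (minimizers f X) < (\<gamma> * \<mu> / \<rho>) powr (\<delta> / (\<delta> * (1 + \<nu>) - 1))}"

definition projected_subgradient_seq ::
    "('a::euclidean_space \<Rightarrow> ereal) \<Rightarrow> 'a set \<Rightarrow> (nat \<Rightarrow> real) \<Rightarrow> (nat \<Rightarrow> 'a) \<Rightarrow> bool" where
  "projected_subgradient_seq f X \<alpha> x \<longleftrightarrow>
     (\<forall>k. \<exists>\<zeta>\<in>clarke_subdiff f (x k).
        x (Suc k) = (if \<zeta> = 0 then x k
                     else closest_point X (x k - (\<alpha> k / norm \<zeta>) *\<^sub>R \<zeta>)))"

end

theory Submission
  imports Defs
begin

text \<open>
  Write d for the distance from the current iterate to the solution set and p for a nearest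
  solution. On a paraconvex function a Clarke subgradient \<zeta> at x still satisfies the convex
  subgradient inequality up to the error \<rho> |p - x|^(1 + \<nu>) (clarke_subgradient_inequality), so
  the error bound gives  \<zeta> \<bullet> (x - p) \<ge> \<mu> d^(1/\<delta>) - \<rho> d^(1 + \<nu>).  As 1 + \<nu> > 1/\<delta>, the error
  has the higher order in d: within the radius of the tube with \<gamma> = 1/2 it is at most half of
  the gain (powr_le_mult_powr_below_radius). The normalized step and the nonexpansive projection
  then yield the scalar recursion
    d'^2 \<le> d^2 - \<alpha> \<tau> d^(1/\<delta>) + \<alpha>^2.

  The induction compares d with a = A s^(-\<delta> r), where s = k + k0. The right-hand side is not
  monotone in d, since a short distance to the solutions is spoiled by the step length, but on
  [0, a] it is largest at an endpoint (square_minus_powr_le_endpoints). The step-size is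
  \<alpha> = (\<tau>/2) a^(1/\<delta>), which minimizes the value at d = a. The constants are such that with
  q = 2 \<delta> r the value there is a^2 (1 - q/s), while at d = 0 it is a^2 q/s, which is no larger
  because s \<ge> k0 \<ge> 2 q. Bernoulli's inequality  1 - q/s \<le> (s/(s + 1))^q  turns this into the
  next bound A (s + 1)^(-\<delta> r) (scheduled_step_preserves_rate). The second term in the maximum
  defining k0 makes A k0^(-\<delta> r) at most the radius of the tube with \<gamma> = 1/2, so the decreasing
  bound also keeps every iterate in the region where the recursion is valid.
\<close>

section \<open>Continuity of paraconvex functions\<close>

text \<open>
  Both ways of relaxing the penalty, min t (1 - t) to t and the distance to an upper bound, give a
  term that is linear in t; this form suffices for everything below.
\<close>

lemma paraconvex_on_weakD:
  fixes g :: "'a::real_normed_vector \<Rightarrow> real"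
  assumes "paraconvex_on S \<nu> \<rho> (\<lambda>x. ereal (g x))" "x \<in> S" "y \<in> S" "0 \<le> t" "t \<le> 1"
    and "0 \<le> \<rho>" "0 \<le> \<nu>" "norm (x - y) \<le> d"
  shows "g (t *\<^sub>R x + (1 - t) *\<^sub>R y) \<le> t * g x + (1 - t) * g y + \<rho> * t * d powr (1 + \<nu>)"
proof -
  have "ereal (g (t *\<^sub>R x + (1 - t) *\<^sub>R y))
          \<le> ereal t * ereal (g x) + ereal (1 - t) * ereal (g y)
             + ereal (\<rho> * min t (1 - t) * norm (x - y) powr (1 + \<nu>))"
    using assms(1-5) unfolding paraconvex_on_def by fastforce
  then have "g (t *\<^sub>R x + (1 - t) *\<^sub>R y)
      \<le> t * g x + (1 - t) * g y + \<rho> * min t (1 - t) * norm (x - y) powr (1 + \<nu>)"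
    by simp
  also have "\<rho> * min t (1 - t) * norm (x - y) powr (1 + \<nu>) \<le> \<rho> * t * d powr (1 + \<nu>)"
    using assms(4-8) by (intro mult_mono powr_mono2) auto
  finally show ?thesis by simp
qed

text \<open>
  Adding a vertex a to V puts a new point of the hull on a segment from a to the old hull, so
  its value exceeds the larger of g a and the old bound by at most one paraconvexity penalty, and
  penalties are controlled by the diameter of the hull.
\<close>

lemma paraconvex_on_bdd_above_convex_hull:
  fixes g :: "'a::euclidean_space \<Rightarrow> real"
  assumes pc: "paraconvex_on S \<nu> \<rho> (\<lambda>x. ereal (g x))" and "convex S" "0 \<le> \<rho>" "0 \<le> \<nu>"
    and "finite V" "V \<subseteq> S"
  shows "bdd_above (g ` (convex hull V))"
  using assms(5,6)
proof (induction V)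
  case empty
  then show ?case by simp
next
  case (insert a V)
  then obtain M where M: "\<And>y. y \<in> convex hull V \<Longrightarrow> g y \<le> M"
    by (auto simp: bdd_above_def)
  have hull: "convex hull (insert a V) \<subseteq> S"
    using insert.prems \<open>convex S\<close> by (simp add: subset_hull)
  have "bounded (convex hull (insert a V))"
    using insert.hyps by (simp add: finite_imp_bounded bounded_convex_hull)
  then obtain D where D: "\<And>y z. y \<in> convex hull (insert a V) \<Longrightarrow> z \<in> convex hull (insert a V) \<Longrightarrow> norm (y - z) \<le> D"
    by (metis bounded_two_points dist_norm)
  have "g z \<le> max M (g a) + \<rho> * D powr (1 + \<nu>)" if z: "z \<in> convex hull (insert a V)" for z
  proof (cases "V = {}")
    case True
    then show ?thesis using z \<open>0 \<le> \<rho>\<close> by (simp add: add_increasing2)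
  next
    case False
    obtain u b where u: "0 \<le> u" "u \<le> 1" and b: "b \<in> convex hull V"
      and z_eq: "z = (1 - u) *\<^sub>R a + u *\<^sub>R b"
      using z False convex_hull_insert_alt[of a V] by auto
    have bh: "b \<in> convex hull (insert a V)"
      using b hull_mono[of V "insert a V" convex] by auto
    have ah: "a \<in> convex hull (insert a V)"
      by (simp add: hull_inc)
    have "g z \<le> u * g b + (1 - u) * g a + \<rho> * u * D powr (1 + \<nu>)"
      using paraconvex_on_weakD[OF pc, of b a u D] u bh ah hull assms(3,4) D z_eq
      by (auto simp: add.commute)
    also have "u * g b + (1 - u) * g a \<le> max M (g a)"
      using M[OF b] u by (intro convex_bound_le) auto
    also have "\<rho> * u * D powr (1 + \<nu>) \<le> \<rho> * D powr (1 + \<nu>)"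
      using u \<open>0 \<le> \<rho>\<close> by (simp add: mult_left_le mult_right_mono)
    finally show ?thesis by simp
  qed
  then show ?case by (auto simp: bdd_above_def)
qed

text \<open>
  The classical argument for convex functions survives the penalty: near x the function is bounded
  above on a box, the hull of its finitely many vertices. Paraconvexity along the line through x
  and y, extended beyond y for the upper estimate and beyond x for the lower one, bounds
  |g y - g x| by a multiple of |y - x|, because the penalty is linear in t.
\<close>

lemma paraconvex_on_imp_continuous_on:
  fixes g :: "'a::euclidean_space \<Rightarrow> real"
  assumes pc: "paraconvex_on S \<nu> \<rho> (\<lambda>x. ereal (g x))"
    and "open S" "convex S" "0 \<le> \<rho>" "0 \<le> \<nu>"
  shows "continuous_on S g"
proof (rule continuous_at_imp_continuous_on, rule ballI)
  fix x assume "x \<in> S"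
  obtain a b where ab: "x \<in> box a b" "cbox a b \<subseteq> S"
    using \<open>open S\<close> \<open>x \<in> S\<close> by (metis open_contains_cbox)
  obtain V where V: "finite V" "cbox a b = convex hull V"
    using closed_interval_as_convex_hull by metis
  have "V \<subseteq> S"
    using V ab hull_subset[of V convex] by auto
  from paraconvex_on_bdd_above_convex_hull[OF pc \<open>convex S\<close> \<open>0 \<le> \<rho>\<close> \<open>0 \<le> \<nu>\<close> V(1) this]
  obtain M where M: "\<And>y. y \<in> cbox a b \<Longrightarrow> g y \<le> M"
    using V by (auto simp: bdd_above_def)
  obtain e where e: "e > 0" "cball x e \<subseteq> box a b"
    using ab open_contains_cball by (metis open_box)
  have inS: "y \<in> S \<and> g y \<le> M" if "norm (y - x) \<le> e" for y
    using that e ab M box_subset_cbox[of a b] by (auto simp: dist_norm norm_minus_commute subset_iff)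
  define C where "C = M - g x + \<rho> * (2 * e) powr (1 + \<nu>)"
  have lip: "\<bar>g y - g x\<bar> \<le> norm (y - x) / e * C" if y: "norm (y - x) < e" for y
  proof (cases "y = x")
    case False
    define t where "t = norm (y - x) / e"
    have t: "0 < t" "t < 1" "norm (y - x) = t * e"
      using False e y by (auto simp: t_def field_simps)
    \<comment> \<open>The two points of the line through x and y at distance e from x: z lies beyond y, and
      x lies between w and y.\<close>
    define z where "z = x + (1 / t) *\<^sub>R (y - x)"
    define w where "w = x - (1 / t) *\<^sub>R (y - x)"
    have "norm (z - x) = e" "norm (w - x) = e"
      using t e by (simp_all add: z_def w_def)
    then have z: "z \<in> S" "g z \<le> M" and w: "w \<in> S" "g w \<le> M"
      using inS by auto
    have "norm (w - y) \<le> norm (w - x) + norm (x - y)"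
      by (rule order.trans[OF _ norm_triangle_ineq]) simp
    then have wy: "norm (w - y) \<le> 2 * e"
      using \<open>norm (w - x) = e\<close> y by (simp add: norm_minus_commute)
    have "t *\<^sub>R z + (1 - t) *\<^sub>R x = y"
      using t by (simp add: z_def algebra_simps)
    then have "g y \<le> t * g z + (1 - t) * g x + \<rho> * t * (2 * e) powr (1 + \<nu>)"
      using paraconvex_on_weakD[OF pc \<open>z \<in> S\<close> \<open>x \<in> S\<close>, of t "2 * e"]
        t assms(4,5) e \<open>norm (z - x) = e\<close> by simp
    also have "t * g z \<le> t * M"
      using t z by simp
    finally have up: "g y - g x \<le> t * C"
      by (simp add: C_def algebra_simps)
    \<comment> \<open>The weight s is the one for which s w + (1 - s) y = x.\<close>
    define s where "s = t / (1 + t)"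
    have s: "0 \<le> s" "s \<le> 1" "(1 + t) * s = t" "(1 + t) * (1 - s) = 1"
      using t by (auto simp: s_def field_simps)
    have "s *\<^sub>R w + (1 - s) *\<^sub>R y = x + (1 - s - s / t) *\<^sub>R (y - x)"
      by (simp add: w_def algebra_simps)
    also have "1 - s - s / t = 0"
      using t add_pos_pos[of t "t * t"] by (simp add: s_def field_simps)
    finally have "s *\<^sub>R w + (1 - s) *\<^sub>R y = x" by simp
    then have "g x \<le> s * g w + (1 - s) * g y + \<rho> * s * (2 * e) powr (1 + \<nu>)"
      using paraconvex_on_weakD[OF pc \<open>w \<in> S\<close>, of y s "2 * e"] inS[of y] y wy
        s assms(4,5) by simp
    also have "s * g w \<le> s * M"
      using s w by (simp add: mult_left_mono)
    finally have "(1 + t) * g x \<le> (1 + t) * (s * M + (1 - s) * g y + \<rho> * s * (2 * e) powr (1 + \<nu>))"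
      using t by simp
    also have "\<dots> = ((1 + t) * s) * M + ((1 + t) * (1 - s)) * g y + \<rho> * ((1 + t) * s) * (2 * e) powr (1 + \<nu>)"
      by (simp add: algebra_simps)
    finally have "g x - g y \<le> t * C"
      unfolding s by (simp add: C_def algebra_simps)
    with up show ?thesis
      unfolding t_def by linarith
  qed simp
  show "isCont g x"
    unfolding isCont_def LIM_def
  proof (intro allI impI)
    fix d :: real assume "0 < d"
    have C: "0 \<le> C"
      using inS[of x] e \<open>0 \<le> \<rho>\<close> by (simp add: C_def)
    \<comment> \<open>C + 1 instead of C, since C may vanish.\<close>
    define \<eta> where "\<eta> = min e (d * e / (C + 1))"
    have "\<eta> > 0"
      using C e \<open>0 < d\<close> by (simp add: \<eta>_def)
    moreover have "dist (g y) (g x) < d" if "dist y x < \<eta>" for y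
    proof -
      have n: "norm (y - x) < e" "norm (y - x) < d * e / (C + 1)"
        using that by (auto simp: \<eta>_def dist_norm)
      have "\<bar>g y - g x\<bar> \<le> norm (y - x) / e * C"
        using lip n by blast
      also have "\<dots> \<le> norm (y - x) / e * (C + 1)"
        using e by (intro mult_left_mono) auto
      also have "\<dots> < d"
        using n(2) C e by (simp add: field_simps)
      finally show ?thesis by (simp add: dist_real_def)
    qed
    ultimately show "\<exists>s>0. \<forall>y. y \<noteq> x \<and> dist y x < s \<longrightarrow> dist (g y) (g x) < d"
      by blast
  qed
qed

section \<open>Clarke subgradients of paraconvex functions\<close>

text \<open>
  Paraconvexity on the segment from u to u + v bounds the difference quotient at u in the
  direction v by g (u + v) - g u + \<rho> |v|^(1 + \<nu>), uniformly in small t. Clarke's derivative also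
  varies the base point u, so passing to its limit u = x uses continuity of g at both ends, x and
  x + v = y.
\<close>

lemma clarke_subgradient_inequality:
  fixes f :: "'a::euclidean_space \<Rightarrow> ereal"
  assumes fg: "\<And>x. x \<in> S \<Longrightarrow> f x = ereal (g x)"
    and pc: "paraconvex_on S \<nu> \<rho> (\<lambda>x. ereal (g x))"
    and "open S" "convex S" "0 \<le> \<rho>" "0 \<le> \<nu>"
    and "x \<in> S" "y \<in> S" "\<zeta> \<in> clarke_subdiff f x"
  shows "\<zeta> \<bullet> (y - x) \<le> g y - g x + \<rho> * norm (y - x) powr (1 + \<nu>)"
proof -
  define v where "v = y - x"
  define h where "h = (\<lambda>u. g (u + v) - g u + \<rho> * norm v powr (1 + \<nu>))"
  have cont: "isCont g u" if "u \<in> S" for u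
    using paraconvex_on_imp_continuous_on[OF pc assms(3-6)] that \<open>open S\<close>
    by (simp add: continuous_on_eq_continuous_at)
  have yx: "y = x + v" by (simp add: v_def)
  have g1: "(g \<longlongrightarrow> g x) (nhds x)"
    using cont[OF \<open>x \<in> S\<close>] by (simp add: isCont_def tendsto_nhds_iff)
  have g2: "(g \<longlongrightarrow> g (x + v)) (nhds (x + v))"
    using cont[OF \<open>y \<in> S\<close>] yx by (simp add: isCont_def tendsto_nhds_iff)
  have shift: "((\<lambda>u. u + v) \<longlongrightarrow> x + v) (nhds x)"
    by (intro tendsto_add filterlim_ident tendsto_const)
  have hlim: "(h \<longlongrightarrow> h x) (nhds x)"
    unfolding h_def by (intro tendsto_intros g1 filterlim_compose[OF g2 shift])
  have "\<zeta> \<bullet> v \<le> h x + e" if "e > 0" for e :: real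
  proof -
    have evS: "\<forall>\<^sub>F u in nhds x. u \<in> S \<and> u + v \<in> S \<and> h u < h x + e"
    proof (intro eventually_conj)
      show "\<forall>\<^sub>F u in nhds x. u \<in> S"
        using \<open>open S\<close> \<open>x \<in> S\<close> by (simp add: eventually_nhds_in_open)
      show "\<forall>\<^sub>F u in nhds x. u + v \<in> S"
        using topological_tendstoD[OF shift \<open>open S\<close>] \<open>y \<in> S\<close> yx by simp
      show "\<forall>\<^sub>F u in nhds x. h u < h x + e"
        using order_tendstoD(2)[OF hlim] that by simp
    qed
    have evt: "\<forall>\<^sub>F t::real in at_right 0. 0 < t \<and> t < 1"
      by (simp add: eventually_at_right_less eventually_conj eventually_at_right_field, rule exI[of _ 1], simp)
    have "\<forall>\<^sub>F p in nhds x \<times>\<^sub>F at_right (0::real).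
        (case p of (u, t) \<Rightarrow> (f (u + t *\<^sub>R v) - f u) / ereal t) \<le> ereal (h x + e)"
    proof (rule eventually_mono[OF eventually_prodI[OF evS evt]], unfold case_prod_beta)
      fix q :: "'a \<times> real"
      assume q: "(fst q \<in> S \<and> fst q + v \<in> S \<and> h (fst q) < h x + e) \<and> 0 < snd q \<and> snd q < 1"
      define u t where "u = fst q" and "t = snd q"
      have *: "u \<in> S" "u + v \<in> S" "h u < h x + e" "0 < t" "t < 1"
        using q by (auto simp: u_def t_def)
      have eq: "t *\<^sub>R (u + v) + (1 - t) *\<^sub>R u = u + t *\<^sub>R v"
        by (simp add: algebra_simps)
      have "u + t *\<^sub>R v \<in> S"
        using * \<open>convex S\<close> eq by (metis convexD_alt add.commute less_imp_le)
      have "g (u + t *\<^sub>R v) \<le> t * g (u + v) + (1 - t) * g u + \<rho> * t * norm v powr (1 + \<nu>)"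
        using paraconvex_on_weakD[OF pc *(2) *(1), of t "norm v"] * assms(5,6) eq by simp
      then have "(g (u + t *\<^sub>R v) - g u) / t \<le> h u"
        using * by (simp add: h_def field_simps)
      then have "(f (u + t *\<^sub>R v) - f u) / ereal t \<le> ereal (h x + e)"
        using * fg[OF *(1)] fg[OF \<open>u + t *\<^sub>R v \<in> S\<close>] by simp
      then show "(f (fst q + snd q *\<^sub>R v) - f (fst q)) / ereal (snd q) \<le> ereal (h x + e)"
        by (simp add: u_def t_def)
    qed
    then have "clarke_dderiv f x v \<le> ereal (h x + e)"
      unfolding clarke_dderiv_def by (rule Limsup_bounded)
    moreover have "ereal (\<zeta> \<bullet> v) \<le> clarke_dderiv f x v"
      using assms(9) by (simp add: clarke_subdiff_def)
    ultimately have "ereal (\<zeta> \<bullet> v) \<le> ereal (h x + e)"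
      by (rule order.trans[rotated])
    then show ?thesis by simp
  qed
  then have "\<zeta> \<bullet> v \<le> h x"
    by (rule field_le_epsilon)
  then show ?thesis
    by (simp add: h_def v_def)
qed

text \<open>Closedness makes the distance to the solution set attained.\<close>

lemma closed_minimizers:
  fixes f :: "'a::topological_space \<Rightarrow> ereal"
  assumes fg: "\<And>x. x \<in> X \<Longrightarrow> f x = ereal (g x)" and "continuous_on X g" "closed X"
  shows "closed (minimizers f X)"
proof (cases "minimizers f X = {}")
  case False
  then obtain p where p: "p \<in> minimizers f X" by auto
  have "minimizers f X = {y \<in> X. g y \<le> g p}"
    using p fg unfolding minimizers_def is_arg_min_def by (fastforce simp: not_less)
  then show ?thesis
    using continuous_on_closed_Collect_le[OF assms(2) continuous_on_const assms(3)] by simp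
qed simp

section \<open>One projected step\<close>

text \<open>
  The projection fixes p and does not increase distances, so it suffices to expand the square for
  the unprojected step, which has length \<alpha>. The lower bound b must be nonnegative for the
  division by norm \<zeta> to be weakened to division by L.
\<close>

lemma projected_step_dist_le:
  fixes x p \<zeta> :: "'a::euclidean_space"
  assumes "convex X" "closed X" "p \<in> X" and "\<zeta> \<noteq> 0" "norm \<zeta> \<le> L" "0 \<le> \<alpha>"
    and "0 \<le> b" "b \<le> \<zeta> \<bullet> (x - p)"
  shows "(dist (closest_point X (x - (\<alpha> / norm \<zeta>) *\<^sub>R \<zeta>)) p)\<^sup>2 \<le> (dist x p)\<^sup>2 - 2 * \<alpha> * (b / L) + \<alpha>\<^sup>2"
proof -
  let ?y = "x - (\<alpha> / norm \<zeta>) *\<^sub>R \<zeta>"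
  have "dist (closest_point X ?y) (closest_point X p) \<le> dist ?y p"
    using assms(1-3) by (intro closest_point_lipschitz) auto
  then have "(dist (closest_point X ?y) p)\<^sup>2 \<le> (dist ?y p)\<^sup>2"
    using closest_point_self[OF \<open>p \<in> X\<close>] by (simp add: power_mono)
  also have "(dist ?y p)\<^sup>2 = (norm ((x - p) - (\<alpha> / norm \<zeta>) *\<^sub>R \<zeta>))\<^sup>2"
    by (simp add: dist_norm algebra_simps)
  also have "\<dots> = (dist x p)\<^sup>2 - 2 * \<alpha> * ((\<zeta> \<bullet> (x - p)) / norm \<zeta>) + \<alpha>\<^sup>2"
  proof -
    have "(norm (u - c *\<^sub>R \<zeta>))\<^sup>2 = (norm u)\<^sup>2 - 2 * c * (\<zeta> \<bullet> u) + (c * norm \<zeta>)\<^sup>2" for u c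
      unfolding power_mult_distrib power2_norm_eq_inner
      by (simp add: inner_diff_left inner_diff_right inner_commute power2_eq_square)
    from this[of "x - p" "\<alpha> / norm \<zeta>"] show ?thesis
      using \<open>\<zeta> \<noteq> 0\<close> by (simp add: dist_norm)
  qed
  also have "\<dots> \<le> (dist x p)\<^sup>2 - 2 * \<alpha> * (b / L) + \<alpha>\<^sup>2"
  proof -
    have "b / L \<le> (\<zeta> \<bullet> (x - p)) / norm \<zeta>"
      using assms(4,5,7,8) by (intro frac_le) auto
    then have "2 * \<alpha> * (b / L) \<le> 2 * \<alpha> * ((\<zeta> \<bullet> (x - p)) / norm \<zeta>)"
      using \<open>0 \<le> \<alpha>\<close> by (intro mult_left_mono) auto
    then show ?thesis by linarith
  qed
  finally show ?thesis .
qed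

section \<open>The scalar recursion\<close>

text \<open>
  The quotient of the two powers is d^e with e = (\<delta> (1 + \<nu>) - 1) / \<delta> > 0, and the radius is
  c^(1/e). With c = \<mu> / (2 \<rho>) this says that the paraconvexity error is at most half of the
  growth guaranteed by the error bound.
\<close>

lemma powr_le_mult_powr_below_radius:
  fixes c d \<nu> \<delta> :: real
  assumes "0 \<le> d" "0 < \<delta>" "0 < \<delta> * (1 + \<nu>) - 1"
    and d: "d \<le> c powr (\<delta> / (\<delta> * (1 + \<nu>) - 1))" and "0 < c"
  shows "d powr (1 + \<nu>) \<le> c * d powr (1 / \<delta>)"
proof (cases "d = 0")
  case False
  define e where "e = (\<delta> * (1 + \<nu>) - 1) / \<delta>"
  have "0 < e"
    using assms(2,3) by (simp add: e_def)
  moreover have "1 + \<nu> = e + 1 / \<delta>"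
    using assms(2) by (simp add: e_def diff_divide_distrib)
  moreover have "\<delta> / (\<delta> * (1 + \<nu>) - 1) * e = 1"
    unfolding e_def using assms(2,3) by simp
  ultimately have e: "0 < e" "1 + \<nu> = e + 1 / \<delta>" "\<delta> / (\<delta> * (1 + \<nu>) - 1) * e = 1"
    by blast+
  have "d powr e \<le> (c powr (\<delta> / (\<delta> * (1 + \<nu>) - 1))) powr e"
    using d e assms(1) by (intro powr_mono2) auto
  also have "\<dots> = c"
    unfolding powr_powr e(3) using \<open>0 < c\<close> by simp
  finally have "d powr e * d powr (1 / \<delta>) \<le> c * d powr (1 / \<delta>)"
    by (simp add: mult_right_mono)
  then show ?thesis
    unfolding e(2) by (simp add: powr_add)
qed simp

text \<open>
  In the factorization d^q (d^(2 - q) - c) both factors are nondecreasing in d; where the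
  second one is negative the value at d = 0 dominates, and elsewhere the product of nonnegative
  nondecreasing factors is dominated by its value at a.
\<close>

lemma square_minus_powr_le_endpoints:
  fixes d a c q :: real
  assumes "0 \<le> d" "d \<le> a" "0 \<le> q" "q \<le> 2"
  shows "d\<^sup>2 - c * d powr q \<le> max 0 (a\<^sup>2 - c * a powr q)"
proof (cases "d = 0")
  case False
  have factor: "u\<^sup>2 - c * u powr q = u powr q * (u powr (2 - q) - c)" if "0 < u" for u
    using that by (simp add: algebra_simps flip: powr_add)
  show ?thesis
  proof (cases "d powr (2 - q) \<le> c")
    case True
    then have "d powr q * (d powr (2 - q) - c) \<le> 0"
      by (intro mult_nonneg_nonpos) auto
    then show ?thesis
      using factor[of d] False assms(1) by simp
  next
    case False': False
    have "d powr (2 - q) \<le> a powr (2 - q)" "d powr q \<le> a powr q"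
      using assms by (auto intro!: powr_mono2)
    then have "d powr q * (d powr (2 - q) - c) \<le> a powr q * (a powr (2 - q) - c)"
      using False' by (intro mult_mono) auto
    then show ?thesis
      using factor[of d] factor[of a] False assms(1,2) by simp
  qed
qed simp

text \<open>
  A form of Bernoulli's inequality for the exponent -p, obtained from
  (1 + 1/s)^(-p) \<ge> exp (- p/s) \<ge> 1 - p/s.
\<close>

lemma one_minus_le_powr_ratio:
  fixes p s :: real
  assumes "0 \<le> p" "0 < s"
  shows "1 - p / s \<le> (s / (s + 1)) powr p"
proof -
  have "ln ((s + 1) / s) \<le> (s + 1) / s - 1"
    using assms by (intro ln_le_minus_one) simp
  then have "ln (s + 1) - ln s \<le> 1 / s"
    using assms by (simp add: ln_div field_simps)
  then have "p * (ln (s + 1) - ln s) \<le> p * (1 / s)"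
    using assms by (intro mult_left_mono) auto
  then have "- (p / s) \<le> p * ln (s / (s + 1))"
    using assms by (simp add: ln_div algebra_simps)
  then have "exp (- (p / s)) \<le> (s / (s + 1)) powr p"
    using assms by (simp add: powr_def)
  moreover have "1 + - (p / s) \<le> exp (- (p / s))"
    by (rule exp_ge_add_one_self)
  ultimately show ?thesis by simp
qed

text \<open>
  With r = 1 / (2 (1 - \<delta>)) one has 2/\<delta> - 2 = 1/(\<delta> r), so the power a^(2/\<delta>) is a^2 times
  A^(1/(\<delta> r)) / s = 8 \<delta> r / (\<tau>^2 s). This is the reason for the values of r and A: the decrease
  of d^2 at d = a becomes a^2 times 2 \<delta> r / s, exactly the relative decrease of s^(-2 \<delta> r) to
  first order in 1/s.
\<close>

lemma scheduled_step_preserves_rate: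
  fixes d s \<delta> r \<tau> A \<alpha> :: real
  assumes "1 / 2 \<le> \<delta>" "\<delta> < 1" "0 < \<tau>" and r: "r = 1 / (2 * (1 - \<delta>))"
    and A: "A = (8 * \<delta> * r / \<tau>\<^sup>2) powr (\<delta> * r)"
    and \<alpha>: "\<alpha> = 1 / 2 * \<tau> * A powr (1 / \<delta>) * s powr (- r)"
    and s: "4 * \<delta> * r \<le> s" and d: "0 \<le> d" "d \<le> A * s powr (- (\<delta> * r))"
  shows "d\<^sup>2 - \<alpha> * \<tau> * d powr (1 / \<delta>) + \<alpha>\<^sup>2 \<le> (A * (s + 1) powr (- (\<delta> * r)))\<^sup>2"
proof -
  define a where "a = A * s powr (- (\<delta> * r))"
  define p where "p = 2 * \<delta> * r"
  define B where "B = 8 * \<delta> * r / \<tau>\<^sup>2"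
  have rpos: "0 < r" using assms(2) r by simp
  have \<delta>r: "0 < \<delta> * r" using rpos assms(1) by simp
  have spos: "0 < s" using s \<delta>r by simp
  have Bpos: "0 < B" using \<delta>r assms(3) by (simp add: B_def)
  have Apos: "0 < A" using A Bpos by (simp add: B_def[symmetric])
  have apos: "0 < a" using Apos spos by (simp add: a_def)
  have half: "\<alpha> = 1 / 2 * \<tau> * a powr (1 / \<delta>)"
    using Apos spos assms(1) by (simp add: \<alpha> a_def powr_mult powr_powr)
  have scale: "(a powr (1 / \<delta>))\<^sup>2 = a\<^sup>2 * (B / s)"
  proof -
    have e: "2 / \<delta> - 2 = 1 / (\<delta> * r)"
      using assms(1,2) by (simp add: r field_simps)
    have "(a powr (1 / \<delta>))\<^sup>2 = a powr (2 / \<delta>)"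
      using apos by (simp add: powr_power)
    also have "\<dots> = a powr 2 * a powr (2 / \<delta> - 2)"
      by (simp flip: powr_add)
    also have "a powr (2 / \<delta> - 2) = B / s"
    proof -
      have "A powr (1 / (\<delta> * r)) = B"
        unfolding A B_def[symmetric] powr_powr using rpos assms(1) Bpos by simp
      moreover have "(s powr (- (\<delta> * r))) powr (1 / (\<delta> * r)) = 1 / s"
        unfolding powr_powr using rpos assms(1) spos by (simp add: powr_minus_divide)
      ultimately show ?thesis
        using Apos unfolding e a_def by (simp add: powr_mult)
    qed
    finally show ?thesis using apos by simp
  qed
  have sq: "\<alpha>\<^sup>2 = a\<^sup>2 * (p / s)"
    unfolding half power_mult_distrib scale using assms(3) spos
    by (simp add: B_def p_def field_simps power2_eq_square)
  have "\<alpha> * \<tau> * a powr (1 / \<delta>) = 2 * \<alpha>\<^sup>2"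
    unfolding half by (simp add: power2_eq_square)
  then have "d\<^sup>2 - \<alpha> * \<tau> * d powr (1 / \<delta>) \<le> max 0 (a\<^sup>2 - 2 * \<alpha>\<^sup>2)"
    using square_minus_powr_le_endpoints[of d a "1 / \<delta>" "\<alpha> * \<tau>"] d assms(1)
    by (simp add: a_def field_simps)
  then have "d\<^sup>2 - \<alpha> * \<tau> * d powr (1 / \<delta>) + \<alpha>\<^sup>2 \<le> max (\<alpha>\<^sup>2) (a\<^sup>2 - \<alpha>\<^sup>2)"
    by simp
  also have "\<dots> \<le> a\<^sup>2 * (1 - p / s)"
  proof -
    have "p / s \<le> 1 - p / s"
      using s spos by (simp add: p_def field_simps)
    then have "a\<^sup>2 * (p / s) \<le> a\<^sup>2 * (1 - p / s)"
      by (intro mult_left_mono) auto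
    then show ?thesis
      unfolding sq by (simp add: right_diff_distrib)
  qed
  also have "\<dots> \<le> a\<^sup>2 * (s / (s + 1)) powr p"
    using one_minus_le_powr_ratio[of p s] spos \<delta>r by (intro mult_left_mono) (auto simp: p_def)
  also have "\<dots> = (A * (s + 1) powr (- (\<delta> * r)))\<^sup>2"
    using spos by (simp add: a_def p_def power_mult_distrib powr_divide powr_power powr_minus field_simps)
  finally show ?thesis .
qed

theorem theorem4p9:
  fixes f :: "real ^ 'n \<Rightarrow> ereal" and X X' :: "(real ^ 'n) set"
    and fstar :: ereal
    and \<rho> \<nu> \<delta> \<mu> L \<tau> r A lam k0 :: real
    and x :: "nat \<Rightarrow> real ^ 'n"
  assumes "proper_fun f"
    and "X \<noteq> {}" and "closed X" and "convex X" and "X \<subseteq> edom f"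
    and "minimizers f X \<noteq> {}" and "fstar = (INF y\<in>X. f y)"
    and "\<rho> > 0" and "0 < \<nu>" and "\<nu> \<le> 1" and "\<mu> > 0"
    and "1 / (1 + \<nu>) < \<delta>" and "\<delta> < 1"
    and "open X'" and "convex X'" and "X \<subseteq> X'" and "X' \<subseteq> edom f"
    and "paraconvex_on X' \<nu> \<rho> f"
    and "\<forall>y\<in>X. ereal (\<mu> * infdist y (minimizers f X) powr (1 / \<delta>)) \<le> f y - fstar"
    and "ereal L = Sup {ereal (norm \<zeta>) | \<zeta> y. y \<in> tube f X \<nu> \<delta> \<mu> \<rho> 1 \<and> \<zeta> \<in> clarke_subdiff f y}"
    and "0 < L"
    and "\<tau> = \<mu> / L"
    and "r = 1 / (2 * (1 - \<delta>))"
    and "A = (8 * \<delta> * r / \<tau>\<^sup>2) powr (\<delta> * r)"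
    and "lam = 1 / 2 * \<tau> * A powr (1 / \<delta>)"
    and "k0 = max (4 * \<delta> * r)
           (A powr (1 / (\<delta> * r)) * (2 * \<rho> / \<mu>) powr (2 * (1 - \<delta>) / (\<delta> * (1 + \<nu>) - 1)))"
    and "projected_subgradient_seq f X (\<lambda>k. lam * (real k + k0) powr (- r)) x"
    and "x 0 \<in> tube f X \<nu> \<delta> \<mu> \<rho> (1 / 2)"
    and "infdist (x 0) (minimizers f X) \<le> A * k0 powr (- (\<delta> * r))"
  shows "\<forall>k. infdist (x k) (minimizers f X) \<le> A / (real k + k0) powr (\<delta> * r)"
proof -
  note fstar = assms(7) and pos = assms(8-11)
  let ?M = "minimizers f X" and ?D = "\<lambda>y. infdist y (minimizers f X)"
  let ?e = "\<delta> / (\<delta> * (1 + \<nu>) - 1)"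
  define g where "g = (\<lambda>y. real_of_ereal (f y))"
  have fg: "f y = ereal (g y)" if "y \<in> X'" for y
  proof -
    have "f y \<noteq> \<infinity>" "f y \<noteq> -\<infinity>"
      using that assms(1,17) unfolding proper_fun_def edom_def by auto
    then show ?thesis
      by (cases "f y") (auto simp: g_def)
  qed
  have pc: "paraconvex_on X' \<nu> \<rho> (\<lambda>y. ereal (g y))"
    unfolding paraconvex_on_def
  proof (intro ballI)
    fix u v and t :: real
    assume *: "u \<in> X'" "v \<in> X'" "t \<in> {0..1}"
    then have "t *\<^sub>R u + (1 - t) *\<^sub>R v \<in> X'"
      by (intro convexD[OF assms(15)]) auto
    moreover have "f (t *\<^sub>R u + (1 - t) *\<^sub>R v) \<le> ereal t * f u + ereal (1 - t) * f v
        + ereal (\<rho> * min t (1 - t) * norm (u - v) powr (1 + \<nu>))"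
      using assms(18) * unfolding paraconvex_on_def by blast
    ultimately show "ereal (g (t *\<^sub>R u + (1 - t) *\<^sub>R v)) \<le> ereal t * ereal (g u) + ereal (1 - t) * ereal (g v)
        + ereal (\<rho> * min t (1 - t) * norm (u - v) powr (1 + \<nu>))"
      using fg *(1,2) by simp
  qed
  have cont: "continuous_on X g"
    using paraconvex_on_imp_continuous_on[OF pc] assms(14,15,16) pos
    by (auto intro: continuous_on_subset)
  have closedM: "closed ?M"
    using closed_minimizers[OF _ cont assms(3)] fg assms(16) by blast
  have exp_pos: "0 < \<delta> * (1 + \<nu>) - 1"
    using assms(12) pos by (simp add: field_simps)
  have "1 / 2 \<le> 1 / (1 + \<nu>)"
    using pos by (simp add: field_simps)
  then have \<delta>: "1 / 2 \<le> \<delta>" "0 < \<delta>"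
    using assms(12) by linarith+
  have \<tau>: "0 < \<tau>"
    using assms(21,22) pos by simp
  have r: "0 < r"
    using assms(13,23) by simp
  have \<delta>r: "0 < \<delta> * r"
    using r \<delta> by simp
  have A: "0 < A"
    unfolding assms(24) using \<tau> r \<delta> by simp
  have "4 * \<delta> * r \<le> k0"
    unfolding assms(26) by (rule max.cobounded1)
  then have k0: "4 * \<delta> * r \<le> k0" "0 < k0"
    using \<delta>r by linarith+

  \<comment> \<open>The largest of the claimed bounds, the one at k = 0, is at most the radius of the tube with
    \<gamma> = 1/2, by the second term of the maximum.\<close>
  have radius: "A * k0 powr (- (\<delta> * r)) \<le> (1 / 2 * \<mu> / \<rho>) powr ?e"
  proof -
    define m where "m = A powr (1 / (\<delta> * r)) * (2 * \<rho> / \<mu>) powr (2 * (1 - \<delta>) / (\<delta> * (1 + \<nu>) - 1))"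
    have m: "0 < m" "m \<le> k0"
      using A pos by (simp_all add: m_def assms(26))
    have e: "2 * (1 - \<delta>) / (\<delta> * (1 + \<nu>) - 1) * (\<delta> * r) = ?e"
      using assms(13,23) by simp
    have "m powr (\<delta> * r) = A * (2 * \<rho> / \<mu>) powr ?e"
      using A pos r \<delta> unfolding m_def e[symmetric] by (simp add: powr_mult powr_powr)
    moreover have "k0 powr (- (\<delta> * r)) \<le> m powr (- (\<delta> * r))"
      using m \<delta>r by (intro powr_mono2') auto
    ultimately have "A * k0 powr (- (\<delta> * r)) \<le> A * inverse (A * (2 * \<rho> / \<mu>) powr ?e)"
      using A by (simp add: powr_minus)
    also have "\<dots> = inverse ((2 * \<rho> / \<mu>) powr ?e)"
      using A by simp
    also have "\<dots> = (1 / 2 * \<mu> / \<rho>) powr ?e"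
      using pos by (simp add: powr_divide powr_mult)
    finally show ?thesis .
  qed

  have step: "?D (x (Suc k)) \<le> A * (real (Suc k) + k0) powr (- (\<delta> * r)) \<and> x (Suc k) \<in> X"
    if IH: "?D (x k) \<le> A * (real k + k0) powr (- (\<delta> * r))" and xX: "x k \<in> X" for k
  proof -
    define d where "d = ?D (x k)"
    define \<alpha> where "\<alpha> = lam * (real k + k0) powr (- r)"
    define b where "b = \<mu> / 2 * d powr (1 / \<delta>)"
    obtain p where p: "p \<in> ?M" "d = dist (x k) p"
      using infdist_attains_inf[OF closedM assms(6)] unfolding d_def by blast
    have pX: "p \<in> X" "f p = fstar"
      using p(1) unfolding fstar minimizers_def is_arg_min_def
      by (auto intro!: antisym INF_greatest INF_lower simp: not_less)
    have d0: "0 \<le> d" by (simp add: d_def infdist_nonneg)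
    have \<alpha>0: "0 \<le> \<alpha>"
      using \<tau> by (simp add: \<alpha>_def assms(25))
    have "d \<le> A * k0 powr (- (\<delta> * r))"
      using IH A k0 \<delta>r unfolding d_def
      by (elim order.trans) (auto intro!: mult_left_mono powr_mono2')
    then have dR: "d \<le> (1 / 2 * \<mu> / \<rho>) powr ?e"
      using radius by simp
    have "(1 / 2 * \<mu> / \<rho>) powr ?e < (1 * \<mu> / \<rho>) powr ?e"
      using pos \<delta> exp_pos by (intro powr_less_mono2) (auto simp: field_simps)
    then have tube1: "x k \<in> tube f X \<nu> \<delta> \<mu> \<rho> 1"
      using dR xX by (simp add: tube_def d_def)
    have "d powr (1 + \<nu>) \<le> 1 / 2 * \<mu> / \<rho> * d powr (1 / \<delta>)"
      using powr_le_mult_powr_below_radius[OF d0 \<delta>(2) exp_pos dR] pos by simp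
    then have defect: "\<rho> * d powr (1 + \<nu>) \<le> b"
      using pos by (simp add: b_def field_simps)
    have "ereal (\<mu> * d powr (1 / \<delta>)) \<le> f (x k) - f p"
      using assms(19) xX pX(2) by (simp add: d_def)
    then have growth: "\<mu> * d powr (1 / \<delta>) \<le> g (x k) - g p"
      using fg xX pX(1) assms(16) by (simp add: subset_iff)
    obtain \<zeta> where \<zeta>: "\<zeta> \<in> clarke_subdiff f (x k)"
      and next_x: "x (Suc k) = (if \<zeta> = 0 then x k
                     else closest_point X (x k - (\<alpha> / norm \<zeta>) *\<^sub>R \<zeta>))"
      using assms(27) unfolding projected_subgradient_seq_def \<alpha>_def by blast
    have "\<zeta> \<bullet> (p - x k) \<le> g p - g (x k) + \<rho> * norm (p - x k) powr (1 + \<nu>)"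
      using pos xX pX(1) assms(16)
      by (intro clarke_subgradient_inequality[OF fg pc assms(14,15) _ _ _ _ \<zeta>]) auto
    then have "\<zeta> \<bullet> (p - x k) \<le> g p - g (x k) + \<rho> * d powr (1 + \<nu>)"
      by (simp add: p(2) dist_norm norm_minus_commute)
    then have "\<zeta> \<bullet> (p - x k) \<le> - b"
      using growth defect by (simp add: b_def)
    then have angle: "b \<le> \<zeta> \<bullet> (x k - p)"
      by (simp add: inner_diff_right)
    have b0: "0 \<le> b" using pos by (simp add: b_def)
    have "ereal (norm \<zeta>) \<le> ereal L"
      unfolding assms(20) using tube1 \<zeta> by (intro Sup_upper) blast
    then have \<zeta>L: "norm \<zeta> \<le> L" by simp
    have "?D (x (Suc k)) \<le> A * (real k + k0 + 1) powr (- (\<delta> * r)) \<and> x (Suc k) \<in> X"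
    proof (cases "\<zeta> = 0")
      case True
      \<comment> \<open>A zero subgradient in the half tube occurs only at a solution, where the method stays.\<close>
      then have "d = 0"
        using angle b0 pos d0 by (simp add: b_def mult_le_0_iff)
      then show ?thesis
        using True next_x xX A by (simp add: d_def)
    next
      case False
      have "(?D (x (Suc k)))\<^sup>2 \<le> (dist (x (Suc k)) p)\<^sup>2"
        using infdist_le[OF p(1)] by (intro power_mono) (auto simp: infdist_nonneg)
      also have "\<dots> \<le> d\<^sup>2 - 2 * \<alpha> * (b / L) + \<alpha>\<^sup>2"
        using projected_step_dist_le[OF assms(4,3) pX(1) False \<zeta>L \<alpha>0 b0 angle] False next_x p(2)
        by simp
      also have "2 * \<alpha> * (b / L) = \<alpha> * \<tau> * d powr (1 / \<delta>)"
        by (simp add: b_def assms(22))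
      also have "d\<^sup>2 - \<alpha> * \<tau> * d powr (1 / \<delta>) + \<alpha>\<^sup>2 \<le> (A * (real k + k0 + 1) powr (- (\<delta> * r)))\<^sup>2"
        using k0 IH d0
        by (intro scheduled_step_preserves_rate[OF \<delta>(1) assms(13) \<tau> assms(23,24)])
          (auto simp: \<alpha>_def assms(25) d_def)
      finally have "?D (x (Suc k)) \<le> A * (real k + k0 + 1) powr (- (\<delta> * r))"
        by (rule power2_le_imp_le) (use A in simp)
      moreover have "x (Suc k) \<in> X"
        using False next_x closest_point_in_set[OF assms(3,2)] by simp
      ultimately show ?thesis by simp
    qed
    then show ?thesis
      by (simp add: algebra_simps)
  qed
  have "?D (x k) \<le> A * (real k + k0) powr (- (\<delta> * r)) \<and> x k \<in> X" for k
  proof (induction k)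
    case 0
    show ?case using assms(28,29) by (simp add: tube_def)
  next
    case (Suc k)
    then show ?case using step by blast
  qed
  then show ?thesis
    by (simp add: powr_minus divide_inverse)
qed

end
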